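(* Let $[H,G]$ be an interval of finite groups. If $[H,G]$ is top Boolean, then it is w-cyclic, i.e. there is $g \in G$ such that $\langle H, g\rangle = G$.
   Context: An interval of finite groups $[H,G]$ is the lattice of all subgroups $K$ with $H \subseteq K \subseteq G$, where $G$ is a finite group and $H$ a subgroup. The top interval of $[H,G]$ is $[T,G]$, where $T$ is the meet (intersection) of all the coatoms of $[H,G]$. A lattice is Boolean if it is isomorphic to the lattice of subsets of a finite set. The interval $[H,G]$ is called top Boolean if its top interval is a Boolean lattice. *)

theory Defs
  imports "HOL-Algebra.Algebra"
begin

definition subgroup_interval :: "('a, 'b) monoid_scheme \<Rightarrow> 'a set \<Rightarrow> 'a set \<Rightarrow> 'a set gorder" where
  "subgroup_interval G H K =
     \<lparr>carrier = {L. subgroup L G \<and> H \<subseteq> L \<and> L \<subseteq> K}, eq = (=), le = (\<subseteq>)\<rparr>"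

definition powerset_order :: "'a set \<Rightarrow> 'a set gorder" where
  "powerset_order S = \<lparr>carrier = Pow S, eq = (=), le = (\<subseteq>)\<rparr>"

definition coatoms :: "('a, 'b) gorder_scheme \<Rightarrow> 'a set" where
  "coatoms L = {x \<in> carrier L. x \<noteq> \<top>\<^bsub>L\<^esub> \<and>
     (\<forall>y \<in> carrier L. x \<sqsubseteq>\<^bsub>L\<^esub> y \<longrightarrow> y = x \<or> y = \<top>\<^bsub>L\<^esub>)}"

text \<open>For orders whose equivalence is equality. Between lattices, order isomorphisms are the
  same as lattice isomorphisms.\<close>

definition order_isomorphic :: "('a, 'c) gorder_scheme \<Rightarrow> ('b, 'd) gorder_scheme \<Rightarrow> bool" where
  "order_isomorphic L M \<longleftrightarrow>
     (\<exists>f. bij_betw f (carrier L) (carrier M) \<and>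
          (\<forall>x \<in> carrier L. \<forall>y \<in> carrier L. x \<sqsubseteq>\<^bsub>L\<^esub> y \<longleftrightarrow> f x \<sqsubseteq>\<^bsub>M\<^esub> f y))"

text \<open>Every finite set is in bijection with a finite set of natural numbers, so restricting
  to the latter loses nothing.\<close>

definition boolean_lattice :: "('a, 'b) gorder_scheme \<Rightarrow> bool" where
  "boolean_lattice L \<longleftrightarrow>
     lattice L \<and> (\<exists>S :: nat set. finite S \<and> order_isomorphic L (powerset_order S))"

text \<open>The meet is taken in the interval, so it is \<open>carrier G\<close> when there are no coatoms,
  in particular when \<open>H = carrier G\<close>.\<close>

definition coatom_meet :: "('a, 'b) monoid_scheme \<Rightarrow> 'a set \<Rightarrow> 'a set" where
  "coatom_meet G H =
     (let L = subgroup_interval G H (carrier G) in \<Sqinter>\<^bsub>L\<^esub> (coatoms L))"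

definition top_boolean :: "('a, 'b) monoid_scheme \<Rightarrow> 'a set \<Rightarrow> bool" where
  "top_boolean G H \<longleftrightarrow> boolean_lattice (subgroup_interval G (coatom_meet G H) (carrier G))"

definition w_cyclic :: "('a, 'b) monoid_scheme \<Rightarrow> 'a set \<Rightarrow> bool" where
  "w_cyclic G H \<longleftrightarrow> (\<exists>g \<in> carrier G. generate G (H \<union> {g}) = carrier G)"

lemma subgroup_interval_simps [simp]:
  "carrier (subgroup_interval G H K) = {L. subgroup L G \<and> H \<subseteq> L \<and> L \<subseteq> K}"
  "eq (subgroup_interval G H K) = (=)"
  "le (subgroup_interval G H K) = (\<subseteq>)"
  by (simp_all add: subgroup_interval_def)

lemma subgroup_interval_top:
  assumes "group G" "subgroup H G"
  shows "\<top>\<^bsub>subgroup_interval G H (carrier G)\<^esub> = carrier G"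
proof -
  let ?L = "subgroup_interval G H (carrier G)"
  have "greatest ?L (carrier G) (carrier ?L)"
    using assms by (auto simp: greatest_def group.subgroup_self subgroup.subset)
  moreover from this have "A = carrier G" if "greatest ?L A (carrier ?L)" for A
    using that by (simp add: greatest_def) blast
  ultimately show ?thesis
    unfolding top_def by (rule some_equality)
qed

text \<open>The meet of the coatoms is their intersection.\<close>

lemma coatom_meet_eq:
  assumes "group G" "subgroup H G"
  shows "coatom_meet G H =
    carrier G \<inter> \<Inter> {M. subgroup M G \<and> H \<subseteq> M \<and> M \<noteq> carrier G \<and>
      (\<forall>K. subgroup K G \<longrightarrow> M \<subseteq> K \<longrightarrow> K = M \<or> K = carrier G)}"
    (is "_ = carrier G \<inter> \<Inter> ?C")
proof -
  let ?L = "subgroup_interval G H (carrier G)"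
  define C where "C = coatoms ?L"
  define I where "I = carrier G \<inter> \<Inter> C"
  have sG: "K \<subseteq> carrier G" if "subgroup K G" for K
    by (rule subgroup.subset[OF that])
  have sH: "H \<subseteq> K" if "H \<subseteq> M" "M \<subseteq> K" for M K
    by (rule Set.subset_trans[OF that])
  have C_iff: "M \<in> C \<longleftrightarrow> subgroup M G \<and> H \<subseteq> M \<and> M \<noteq> carrier G \<and>
      (\<forall>K. subgroup K G \<longrightarrow> M \<subseteq> K \<longrightarrow> K = M \<or> K = carrier G)" for M
  proof -
    have "M \<in> C \<longleftrightarrow> (subgroup M G \<and> H \<subseteq> M \<and> M \<subseteq> carrier G) \<and> M \<noteq> carrier G \<and>
        (\<forall>K. subgroup K G \<and> H \<subseteq> K \<and> K \<subseteq> carrier G \<longrightarrow> M \<subseteq> K \<longrightarrow> K = M \<or> K = carrier G)"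
      unfolding C_def coatoms_def subgroup_interval_top[OF assms] subgroup_interval_simps
        mem_Collect_eq Ball_def ..
    also have "\<dots> \<longleftrightarrow> subgroup M G \<and> H \<subseteq> M \<and> M \<noteq> carrier G \<and>
        (\<forall>K. subgroup K G \<longrightarrow> M \<subseteq> K \<longrightarrow> K = M \<or> K = carrier G)"
    proof (cases "subgroup M G \<and> H \<subseteq> M")
      case True
      then have "(subgroup K G \<and> H \<subseteq> K \<and> K \<subseteq> carrier G \<longrightarrow> M \<subseteq> K \<longrightarrow> P) \<longleftrightarrow>
          (subgroup K G \<longrightarrow> M \<subseteq> K \<longrightarrow> P)" for K P
        using sG[of K] sH[of M K] by argo
      with True sG[of M] show ?thesis by presburger
    qed argo
    finally show ?thesis .
  qed
  have C: "C = ?C"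
    by (rule Set.set_eqI) (simp only: C_iff mem_Collect_eq)
  have "subgroup (\<Inter> (insert (carrier G) C)) G"
    by (rule group.subgroups_Inter[OF assms(1)])
       (use C_iff group.subgroup_self[OF assms(1)] in blast)+
  then have I: "subgroup I G" by (simp add: I_def)
  have "H \<subseteq> I"
    using sG[OF assms(2)] C_iff unfolding I_def by blast
  then have I_mem: "I \<in> carrier ?L"
    using I sG[OF I] by simp
  have C_sub: "C \<subseteq> carrier ?L"
    by (auto simp: C_def coatoms_def)
  have gr: "greatest ?L I (Lower ?L C)"
    unfolding greatest_def
  proof (intro conjI ballI)
    show "Lower ?L C \<subseteq> carrier ?L" by (rule Lower_closed)
    show "I \<in> Lower ?L C"
      using I_mem unfolding Lower_def subgroup_interval_simps(3) I_def by blast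
  next
    fix A assume A: "A \<in> Lower ?L C"
    have "A \<subseteq> carrier G" using A by (simp add: Lower_def)
    moreover have "A \<subseteq> M" if "M \<in> C" for M
      using A that C_sub unfolding Lower_def subgroup_interval_simps(3) by blast
    ultimately show "A \<sqsubseteq>\<^bsub>?L\<^esub> I" unfolding I_def subgroup_interval_simps(3) by blast
  qed
  have "\<Sqinter>\<^bsub>?L\<^esub> C = I"
    unfolding Lattice.inf_def
  proof (rule some_equality)
    show "greatest ?L I (Lower ?L C)" by (rule gr)
    fix A assume A: "greatest ?L A (Lower ?L C)"
    show "A = I"
    proof (rule subset_antisym)
      show "A \<subseteq> I" using A gr unfolding greatest_def subgroup_interval_simps by blast
      show "I \<subseteq> A" using A gr unfolding greatest_def subgroup_interval_simps by blast
    qed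
  qed
  then show ?thesis
    unfolding coatom_meet_def Let_def C_def[symmetric] I_def C .
qed

end

theory Submission
  imports Defs
begin

text \<open>Let \<open>T\<close> be the meet of the coatoms, and let \<open>f\<close> be an isomorphism from \<open>[T, G]\<close> to the
  subsets of a finite set. Every \<open>K\<close> in \<open>[T, G]\<close> is of the form \<open>\<langle>T, g\<rangle>\<close>, by induction on \<open>f K\<close>: let
  \<open>f K\<close> be the disjoint union of \<open>Y = f A\<close> and \<open>{x} = f B\<close>, where \<open>A = \<langle>T, a\<rangle>\<close> and \<open>B = \<langle>T, b\<rangle>\<close>. A
  subgroup containing \<open>\<langle>T, ab\<rangle>\<close> contains \<open>A\<close> iff it contains \<open>B\<close>, so with \<open>Z = f \<langle>T, ab\<rangle>\<close> both
  \<open>Z \<union> Y\<close> and \<open>Z \<union> {x}\<close> contain \<open>Y \<union> {x}\<close>, and thus \<open>Z = Y \<union> {x}\<close>. For \<open>K = G\<close> this gives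
  \<open>\<langle>T, g\<rangle> = G\<close>. Then \<open>\<langle>H, g\<rangle> = G\<close> as well, because \<open>T\<close> lies in all coatoms of \<open>[H, G]\<close>, so that a
  coatom containing \<open>H\<close> and \<open>g\<close> would contain \<open>G\<close>.\<close>

lemma (in group) boolean_interval_generated:
  assumes T: "subgroup T G"
    and "boolean_lattice (subgroup_interval G T (carrier G))"
    and "subgroup K G" "T \<subseteq> K"
  shows "\<exists>g \<in> K. generate G (T \<union> {g}) = K"
proof -
  define I where "I = {L. subgroup L G \<and> T \<subseteq> L}"
  have I_eq: "{L. subgroup L G \<and> T \<subseteq> L \<and> L \<subseteq> carrier G} = I"
    using subgroup.subset by (auto simp: I_def)
  obtain S :: "nat set" and f where fin: "finite S" and bij: "bij_betw f I (Pow S)"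
    and le: "\<And>x y. x \<in> I \<Longrightarrow> y \<in> I \<Longrightarrow> x \<subseteq> y \<longleftrightarrow> f x \<subseteq> f y"
    using assms(2)
    by (auto simp: boolean_lattice_def order_isomorphic_def I_eq powerset_order_def)
  define h where "h = inv_into I f"
  have h: "h U \<in> I" "f (h U) = U" if "U \<subseteq> S" for U
    using that bij inv_into_into[of U f I] f_inv_into_f[of U f I]
    by (simp_all add: h_def bij_betw_def)
  have fS: "f L \<subseteq> S" if "L \<in> I" for L
    using bij that by (auto simp: bij_betw_def)
  have hf: "h (f L) = L" if "L \<in> I" for L
    using bij that by (simp add: h_def bij_betw_def)
  have TI: "T \<in> I" using T by (simp add: I_def)
  have genI: "generate G (T \<union> {g}) \<in> I" if "g \<in> carrier G" for g
  proof -
    have "T \<union> {g} \<subseteq> carrier G" using that subgroup.subset[OF T] by auto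
    then show ?thesis
      by (auto simp: I_def intro: generate_is_subgroup generate.incl)
  qed
  have gen_mem: "g \<in> generate G (T \<union> {g})" for g by (simp add: generate.incl)
  have gen_le: "generate G (T \<union> {g}) \<subseteq> L" if "L \<in> I" "g \<in> L" for g L
    using that by (intro generate_subgroup_incl) (auto simp: I_def)
  have sub: "L \<subseteq> carrier G" if "L \<in> I" for L
    using that by (simp add: I_def subgroup.subset)
  \<comment> \<open>The induction runs over the subset \<open>U\<close>; every \<open>K\<close> in
    \<open>I\<close> is reached as \<open>h (f K)\<close>.\<close>
  have "\<exists>g \<in> h U. generate G (T \<union> {g}) = h U" if "finite U" "U \<subseteq> S" for U
    using that
  proof (induction U)
    case empty
    \<comment> \<open>\<open>T\<close> is least in the interval, so it corresponds to the empty set;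
      \<open>\<one>\<close> serves as generator.\<close>
    have "h {} = T"
      using h[of "{}"] le[of "h {}" T] TI by (auto simp: I_def)
    moreover have "generate G (T \<union> {\<one>}) = T"
      using gen_le[OF TI subgroup.one_closed[OF T]] genI[OF one_closed] by (simp add: I_def)
    ultimately show ?case using T by (auto intro: subgroup.one_closed)
  next
    case (insert x Y)
    define A B C where "A = h Y" and "B = h {x}" and "C = h (insert x Y)"
    have A: "A \<in> I" "f A = Y" and B: "B \<in> I" "f B = {x}" and C: "C \<in> I" "f C = insert x Y"
      using insert.prems h by (auto simp: A_def B_def C_def)
    obtain a where a: "a \<in> A" "generate G (T \<union> {a}) = A"
      using insert by (auto simp: A_def)
    have "f T = {}"
      using le[OF TI h(1)[of "{}"]] h(2)[of "{}"] h(1)[of "{}"] by (auto simp: I_def)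
    then have "\<not> B \<subseteq> T" using B le[OF B(1) TI] by auto
    then obtain b where b: "b \<in> B" "b \<notin> T" by blast
    have ac: "a \<in> carrier G" and bc: "b \<in> carrier G"
      using a b A B sub by auto
    \<comment> \<open>\<open>B\<close> is an atom over \<open>T\<close>: the image of
      \<open>\<langle>T, b\<rangle>\<close> is a nonempty subset of \<open>{x}\<close>.\<close>
    have B_gen: "generate G (T \<union> {b}) = B"
    proof -
      have "\<not> f (generate G (T \<union> {b})) \<subseteq> {}"
        using le[OF genI[OF bc] TI] \<open>f T = {}\<close> gen_mem[of b] b by auto
      moreover have "f (generate G (T \<union> {b})) \<subseteq> {x}"
        using le[OF genI[OF bc] B(1)] gen_le[OF B(1) b(1)] B by simp
      ultimately have "f (generate G (T \<union> {b})) = f B" using B by auto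
      then show ?thesis using hf genI[OF bc] B(1) by metis
    qed
    define g where "g = a \<otimes> b"
    have gc: "g \<in> carrier G" using ac bc by (simp add: g_def)
    define K where "K = generate G (T \<union> {g})"
    have K: "K \<in> I" "g \<in> K" using genI[OF gc] gen_mem by (auto simp: K_def)
    have AC: "A \<subseteq> C" and BC: "B \<subseteq> C" using le A B C by auto
    have gC: "g \<in> C"
      unfolding g_def using AC BC a b C
      by (auto simp: I_def intro: subgroup.m_closed)
    have KC: "f K \<subseteq> insert x Y"
      using gen_le[OF C(1) gC] le[OF K(1) C(1)] C by (simp add: K_def)
    have "A \<subseteq> L \<longleftrightarrow> B \<subseteq> L" if L: "L \<in> I" "K \<subseteq> L" for L
    proof -
      interpret L: subgroup L G using L by (simp add: I_def)
      have gL: "g \<in> L" using L K by auto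
      have "b = inv a \<otimes> g" and "a = g \<otimes> inv b"
        using ac bc by (simp_all add: g_def m_assoc inv_solve_left inv_solve_right)
      then have "a \<in> L \<longleftrightarrow> b \<in> L"
        using gL L.m_closed L.m_inv_closed by metis
      then show ?thesis
        using a b gen_le[OF L(1)] B_gen by blast
    qed
    \<comment> \<open>Apply the equivalence to \<open>L = h W\<close>, which contains
      \<open>K\<close> because \<open>f K \<subseteq> W\<close>.\<close>
    then have iff: "Y \<subseteq> W \<longleftrightarrow> {x} \<subseteq> W" if "f K \<subseteq> W" "W \<subseteq> S" for W
      using that h[of W] le[of K "h W"] le[of A "h W"] le[of B "h W"] A B K by simp
    \<comment> \<open>The set \<open>f K \<union> Y\<close> contains \<open>Y\<close>, hence
      \<open>x\<close>, and \<open>x\<close> is not in \<open>Y\<close>.\<close>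
    have "x \<in> f K"
      using iff[of "f K \<union> Y"] fS[OF K(1)] insert by auto
    moreover from this have "Y \<subseteq> f K" using iff[of "f K"] fS[OF K(1)] by auto
    ultimately have "f K = f C" using KC C by auto
    then have "K = C" using hf K(1) C(1) by metis
    then show ?case using K by (auto simp: K_def C_def)
  qed
  moreover have "K \<in> I" using assms by (simp add: I_def)
  ultimately show ?thesis
    using hf fS finite_subset[OF _ fin] by metis
qed

text \<open>By finiteness, some proper subgroup above \<open>K\<close> is maximal. It is then a
  coatom of \<open>[H, G]\<close> for every subgroup \<open>H\<close> inside it.\<close>

lemma proper_subgroup_le_coatom:
  assumes "finite (carrier G)" "subgroup K G" "K \<noteq> carrier G"
  obtains M where "subgroup M G" "K \<subseteq> M" "M \<noteq> carrier G"
    "\<And>L. subgroup L G \<Longrightarrow> M \<subseteq> L \<Longrightarrow> L = M \<or> L = carrier G"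
proof -
  let ?P = "{M. subgroup M G \<and> M \<noteq> carrier G}"
  have "finite ?P"
    by (rule finite_subset[of _ "Pow (carrier G)"])
       (use assms(1) subgroup.subset in auto)
  then obtain M where "M \<in> ?P" "K \<subseteq> M" "\<forall>L\<in>?P. M \<subseteq> L \<longrightarrow> M = L"
    using finite_has_maximal2[of ?P K] assms by auto
  then show thesis by (intro that[of M]) auto
qed

lemma (in group) subgroup_coatom_meet:
  assumes "subgroup H G"
  shows "subgroup (coatom_meet G H) G"
proof -
  let ?C = "{M. subgroup M G \<and> H \<subseteq> M \<and> M \<noteq> carrier G \<and>
      (\<forall>K. subgroup K G \<longrightarrow> M \<subseteq> K \<longrightarrow> K = M \<or> K = carrier G)}"
  \<comment> \<open>Inserting \<open>carrier G\<close> keeps the family nonempty when there are no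
    coatoms.\<close>
  have "subgroup (\<Inter> (insert (carrier G) ?C)) G"
    by (rule subgroups_Inter) (auto intro: subgroup_self)
  then show ?thesis by (simp add: coatom_meet_eq[OF is_group assms])
qed

theorem theorem3p4:
  fixes G :: "('a, 'b) monoid_scheme" and H :: "'a set"
  assumes "group G"
    and "finite (carrier G)"
    and "subgroup H G"
    and "top_boolean G H"
  shows "w_cyclic G H"
proof -
  interpret group G by fact
  let ?T = "coatom_meet G H"
  have T: "subgroup ?T G" by (rule subgroup_coatom_meet[OF assms(3)])
  obtain g where g: "g \<in> carrier G" "generate G (?T \<union> {g}) = carrier G"
    using boolean_interval_generated[OF T _ subgroup_self subgroup.subset[OF T]] assms(4)
    by (auto simp: top_boolean_def)
  have Hg: "H \<union> {g} \<subseteq> carrier G" using g subgroup.subset[OF assms(3)] by auto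
  have "generate G (H \<union> {g}) = carrier G"
  proof (rule ccontr)
    assume "generate G (H \<union> {g}) \<noteq> carrier G"
    then obtain M where M: "subgroup M G" "generate G (H \<union> {g}) \<subseteq> M" "M \<noteq> carrier G"
      "\<And>L. subgroup L G \<Longrightarrow> M \<subseteq> L \<Longrightarrow> L = M \<or> L = carrier G"
      using proper_subgroup_le_coatom[OF assms(2) generate_is_subgroup[OF Hg]] by metis
    have HM: "H \<union> {g} \<subseteq> M" using M(2) by (blast intro: generate.incl)
    then have "?T \<subseteq> M"
      unfolding coatom_meet_eq[OF assms(1,3)] using M by blast
    then have "carrier G \<subseteq> M"
      using generate_subgroup_incl[OF _ M(1), of "?T \<union> {g}"] HM g by auto
    then show False using M(3) subgroup.subset[OF M(1)] by auto
  qed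
  then show ?thesis using g by (auto simp: w_cyclic_def)
qed

end
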